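(* Let $x^{***}$ be the unique solution $x>e$ of the equation $\ln(x)-\ln(\ln(x))=\sqrt{2\ln(2)}$ (so $x^{***}\in(5.580,5.581)$). Fix any $x>x^{***}$ and define $\lambda_0(x)=\ln(x)$ and $\lambda_{n+1}(x)=\ln(x)-\ln(\lambda_n(x))$ for $n\in\mathbb{N}$. Then the sequence $(\lambda_n(x))_{n\in\mathbb{N}}$ converges and $\lim_{n\to+\infty}\lambda_n(x)=\mathrm{W}_0(x)$. Moreover, for every $n\in\mathbb{N}$, $$0<\lambda_{2n}(x)-\mathrm{W}_0(x)\le\left(\frac{\sqrt{2\ln(2)}}{\ln(x)-\ln(\ln(x))}\right)^{2n}\ln(\ln(x)).$$
   Context: $\mathbb{N}=\{0,1,2,\ldots\}$. $\mathrm{W}_0:[-1/e,\infty)\to[-1,\infty)$ is the principal real branch of the Lambert function: $\mathrm{W}_0(x)$ is the unique $w\ge -1$ with $we^w=x$. *)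

theory Defs
  imports Complex_Main
begin

text \<open>
  Principal real branch of the Lambert function. It is meaningful only for
  \<open>x \<ge> - exp (- 1)\<close>, where \<open>ex1_Lambert_W0\<close> below justifies the description.
\<close>
definition Lambert_W0 :: "real \<Rightarrow> real" where
  "Lambert_W0 x = (THE w. w \<ge> - 1 \<and> w * exp w = x)"

lemma ex1_Lambert_W0:
  fixes x :: real
  assumes "x \<ge> - exp (- 1)"
  shows "\<exists>!w. w \<ge> - 1 \<and> w * exp w = x"
proof (rule ex_ex1I)
  have cont: "continuous_on {- 1..max 0 x} (\<lambda>w::real. w * exp w)"
    by (intro continuous_intros)
  have "x \<le> max 0 x * exp (max 0 x)"
    using mult_left_mono[of 1 "exp x" x] by (simp add: max_def)
  then show "\<exists>w. w \<ge> - 1 \<and> w * exp w = x"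
    using IVT'[of "\<lambda>w::real. w * exp w" "- 1" x "max 0 x"] cont assms by (auto simp: le_max_iff_disj)
next
  have less: "a * exp a < b * exp b" if "- 1 \<le> a" "a < b" for a b :: real
  proof (rule DERIV_pos_imp_increasing_open[OF \<open>a < b\<close>])
    fix t assume t: "a < t" "t < b"
    have "((\<lambda>w. w * exp w) has_real_derivative (1 + t) * exp t) (at t)"
      by (auto intro!: derivative_eq_intros simp: algebra_simps)
    moreover have "(1 + t) * exp t > 0" using t that by simp
    ultimately show "\<exists>y. ((\<lambda>w. w * exp w) has_real_derivative y) (at t) \<and> 0 < y" by blast
  qed (intro continuous_intros)
  fix v w assume "v \<ge> - 1 \<and> v * exp v = x" "w \<ge> - 1 \<and> w * exp w = x"
  then show "v = w" using less[of v w] less[of w v] by (cases v w rule: linorder_cases) auto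
qed

primrec lambda_seq :: "real \<Rightarrow> nat \<Rightarrow> real" where
  "lambda_seq x 0 = ln x"
| "lambda_seq x (Suc n) = ln x - ln (lambda_seq x n)"

definition is_x_star3 :: "real \<Rightarrow> bool" where
  "is_x_star3 x \<longleftrightarrow> x > exp 1 \<and> ln x - ln (ln x) = sqrt (2 * ln 2)"

definition x_star3 :: real where
  "x_star3 = (THE x. is_x_star3 x)"

end

theory Submission
  imports Defs "HOL-Analysis.Harmonic_Numbers"
begin

text \<open>
  Let \<open>w = W\<^sub>0(x)\<close>, so that \<open>w + ln w = ln x\<close>. The iteration map \<open>g(t) = ln x - ln t\<close> is
  decreasing and fixes \<open>w\<close>, so the iterates alternate around \<open>w\<close> and stay above
  \<open>m = g(ln x) = ln x - ln (ln x)\<close>. There \<open>|g'| \<le> 1/m\<close>, so each step contracts the distance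
  to \<open>w\<close>, initially \<open>ln w < ln (ln x)\<close>, by the factor \<open>1/m\<close>. For \<open>x > x\<^sup>*\<^sup>*\<^sup>*\<close> we have
  \<open>m > sqrt (2 ln 2) > 1\<close>, which gives convergence and a bound stronger than the one claimed.
\<close>

section \<open>Monotonicity and Lipschitz bounds involving the logarithm\<close>

lemma strict_mono_on_diff_ln: "strict_mono_on {1..} (\<lambda>t::real. t - ln t)"
proof (rule strict_mono_onI)
  fix a b :: real
  assume "a \<in> {1..}" "b \<in> {1..}" "a < b"
  then have "ln b - ln a < (b - a) / a" "(b - a) / a \<le> b - a"
    using ln_diff_less[of b a] by (auto simp: divide_le_eq mult_le_cancel_left1)
  then show "a - ln a < b - ln b" by linarith
qed

text \<open>Used with logarithms as arguments: it makes \<open>ln x - ln (ln x)\<close> strictly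
  increasing in \<open>x > exp 1\<close>.\<close>

lemma diff_ln_less_iff:
  fixes a b :: real
  assumes "1 \<le> a" "1 \<le> b"
  shows "a - ln a < b - ln b \<longleftrightarrow> a < b"
  using strict_mono_on_less[OF strict_mono_on_diff_ln] assms by auto

lemma exp_1_less_iff: "exp 1 < x \<longleftrightarrow> x > 0 \<and> ln x > (1::real)"
  by (metis exp_gt_zero exp_less_cancel_iff exp_ln less_trans)

text \<open>The slope of \<open>ln\<close> is at most \<open>1 / m\<close> from \<open>m\<close> on;
  this is the contraction factor of the iteration.\<close>

lemma abs_ln_diff_le:
  fixes a b m :: real
  assumes "0 < m" "m \<le> a" "m \<le> b"
  shows "\<bar>ln a - ln b\<bar> \<le> \<bar>a - b\<bar> / m"
  using assms
proof (induction a b rule: linorder_wlog)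
  case (le a b)
  have "ln b - ln a \<le> (b - a) / a" using le by (intro ln_diff_le) auto
  also have "\<dots> \<le> (b - a) / m" using le by (intro divide_left_mono) auto
  finally show ?case using le by auto
next
  case (sym a b)
  then show ?case by (simp add: abs_minus_commute)
qed

section \<open>Numerical estimates at 5.580 and 5.581\<close>

lemma ln_2_bounds: "ln (2::real) \<in> {6931471/10000000..6931472/10000000}"
  using ln_approx_bounds[of 2 7] by (simp add: eval_nat_numeral)

lemma ln_5580_less: "ln (5.580::real) < 1.7192"
proof -
  \<comment> \<open>Since 5.580 = 4 * 1.395, splitting off \<open>2 * ln 2\<close> leaves an
    argument closer to 1, where few series terms suffice.\<close>
  have "ln (1.395::real) \<le> 0.3329"
    using ln_approx_bounds[of "1.395" 4] by (simp add: eval_nat_numeral)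
  moreover have "ln (5.580::real) = 2 * ln 2 + ln 1.395"
    using ln_mult_pos[of "2^2" "1.395::real"] ln_realpow[of 2 2] by simp
  ultimately show ?thesis using ln_2_bounds by simp
qed

text \<open>
  The margin at \<open>5.581\<close> is only about \<open>10\<^sup>-\<^sup>6\<close>; \<open>435 / 253\<close> is the rational of least
  denominator below \<open>ln 5.581\<close> that is still close enough to it.
\<close>
lemma ln_5581_greater: "435 / 253 < ln (5.581::real)"
proof -
  have "0.3330735 \<le> ln (1.39525::real)"
    using ln_approx_bounds[of "1.39525" 5] by (simp add: eval_nat_numeral)
  moreover have "ln (5.581::real) = 2 * ln 2 + ln 1.39525"
    using ln_mult_pos[of "2^2" "1.39525::real"] ln_realpow[of 2 2] by simp
  ultimately show ?thesis using ln_2_bounds by simp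
qed

text \<open>The bounds must lie strictly between 1.7192 - 0.54185 and 435/253 - 0.541957, the values
  reached at 5.580 and 5.581; the upper one clears by less than \<open>10^-6\<close>.\<close>

lemma sqrt_2_ln_2_bounds: "sqrt (2 * ln 2) \<in> {1.17736<..1.1774101}"
proof -
  have "1.17736 < sqrt (2 * ln (2::real))"
    by (rule real_less_rsqrt) (use ln_2_bounds in \<open>simp add: power2_eq_square\<close>)
  moreover have "sqrt (2 * ln (2::real)) \<le> 1.1774101"
    by (rule real_le_lsqrt) (use ln_2_bounds in \<open>simp_all add: power2_eq_square\<close>)
  ultimately show ?thesis by simp
qed

lemma diff_ln_5580_less: "ln 5.580 - ln (ln 5.580) < sqrt (2 * ln 2)"
proof -
  have "1 < ln (5.580::real)"
    using exp_le exp_1_less_iff[of "5.580"] by simp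
  \<comment> \<open>As \<open>t - ln t\<close> increases for t \<ge> 1, \<open>ln 5.580\<close> may
    be replaced by its upper bound.\<close>
  then have "ln 5.580 - ln (ln 5.580) < 1.7192 - ln (1.7192::real)"
    using ln_5580_less by (subst diff_ln_less_iff) auto
  moreover have "0.54185 \<le> ln (1.7192::real)"
    using ln_approx_bounds[of "1.7192" 6] by (simp add: eval_nat_numeral)
  ultimately show ?thesis using sqrt_2_ln_2_bounds by simp
qed

lemma diff_ln_5581_greater: "sqrt (2 * ln 2) < ln 5.581 - ln (ln 5.581)"
proof -
  have "435 / 253 - ln (435 / 253 :: real) < ln 5.581 - ln (ln 5.581)"
    using ln_5581_greater by (subst diff_ln_less_iff) auto
  moreover have "ln (435 / 253 :: real) \<le> 0.541957"
    using ln_approx_bounds[of "435 / 253" 6] by (simp add: eval_nat_numeral)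
  ultimately show ?thesis using sqrt_2_ln_2_bounds by simp
qed

section \<open>Existence, uniqueness and location of the threshold\<close>

lemma is_x_star3_less_iff:
  assumes "is_x_star3 y" "x > exp 1"
  shows "x < y \<longleftrightarrow> ln x - ln (ln x) < sqrt (2 * ln 2)"
    and "y < x \<longleftrightarrow> sqrt (2 * ln 2) < ln x - ln (ln x)"
proof -
  have y: "y > 0" "ln y > 1" "sqrt (2 * ln 2) = ln y - ln (ln y)"
    using assms(1) by (auto simp: is_x_star3_def exp_1_less_iff)
  have x: "x > 0" "ln x > 1"
    using assms(2) by (auto simp: exp_1_less_iff)
  show "x < y \<longleftrightarrow> ln x - ln (ln x) < sqrt (2 * ln 2)"
    unfolding y(3) using x y by (subst diff_ln_less_iff) auto
  show "y < x \<longleftrightarrow> sqrt (2 * ln 2) < ln x - ln (ln x)"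
    unfolding y(3) using x y by (subst diff_ln_less_iff) auto
qed

lemma ex1_is_x_star3: "\<exists>!x. is_x_star3 x"
proof (rule ex_ex1I)
  let ?f = "\<lambda>x::real. ln x - ln (ln x)"
  \<comment> \<open>\<open>exp_le\<close> is e \<le> 3. Hence \<open>ln (ln x)\<close> is continuous
    on the interval used for the intermediate value theorem.\<close>
  have gt_1: "ln x > 1" if "x \<ge> 5.580" for x :: real
    using that exp_le exp_1_less_iff[of x] by simp
  have "continuous_on {5.580..5.581} ?f"
  proof (intro continuous_intros ballI)
    fix x :: real assume "x \<in> {5.580..5.581}"
    then show "x \<noteq> 0" "ln x \<noteq> 0" using gt_1[of x] by auto
  qed (use gt_1 in auto)
  then obtain x where x: "5.580 \<le> x" "x \<le> 5.581" "?f x = sqrt (2 * ln 2)"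
    using IVT'[of ?f "5.580" "sqrt (2 * ln 2)" "5.581"] diff_ln_5580_less diff_ln_5581_greater
    by auto
  moreover have "x > exp 1" using x(1) exp_le by simp
  ultimately show "\<exists>x. is_x_star3 x" by (auto simp: is_x_star3_def)
next
  fix x y assume "is_x_star3 x" "is_x_star3 y"
  \<comment> \<open>Both points give the same value, so the comparison excludes either strict
    order.\<close>
  then show "x = y"
    using is_x_star3_less_iff[of y x] by (auto simp: is_x_star3_def)
qed

lemma is_x_star3_x_star3: "is_x_star3 x_star3"
  unfolding x_star3_def using ex1_is_x_star3 by (rule theI')

lemma x_star3_bounds: "x_star3 \<in> {5.580<..<5.581}"
proof -
  have "exp 1 < (5.580::real)" "exp 1 < (5.581::real)" using exp_le by simp_all
  then show ?thesis
    using is_x_star3_less_iff[OF is_x_star3_x_star3] diff_ln_5580_less diff_ln_5581_greater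
    by (simp only: greaterThanLessThan_iff)
qed

section \<open>The Lambert function above e\<close>

lemma Lambert_W0:
  assumes "x \<ge> - exp (- 1)"
  shows "Lambert_W0 x \<ge> - 1" "Lambert_W0 x * exp (Lambert_W0 x) = x"
  using theI'[OF ex1_Lambert_W0[OF assms]] by (simp_all add: Lambert_W0_def)

text \<open>Otherwise x = w * exp w \<le> exp w \<le> e.\<close>

lemma Lambert_W0_gt_1:
  assumes "x > exp 1"
  shows "Lambert_W0 x > 1"
proof (rule ccontr)
  let ?w = "Lambert_W0 x"
  assume "\<not> ?w > 1"
  moreover have "x \<ge> - exp (- 1)"
    using assms exp_gt_zero[of 1] exp_gt_zero[of "- 1"] by linarith
  ultimately have "x \<le> exp ?w" "exp ?w \<le> exp 1"
    using Lambert_W0(2)[of x] mult_right_mono[of ?w 1 "exp ?w"] by auto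
  then show False using assms by linarith
qed

text \<open>The logarithm of \<open>w * exp w = x\<close>: it makes w a fixed point of the
  iteration.\<close>

lemma Lambert_W0_plus_ln:
  assumes "x > exp 1"
  shows "Lambert_W0 x + ln (Lambert_W0 x) = ln x"
proof -
  let ?w = "Lambert_W0 x"
  have "x \<ge> - exp (- 1)"
    using assms exp_gt_zero[of 1] exp_gt_zero[of "- 1"] by linarith
  then have "ln x = ln (?w * exp ?w)"
    using Lambert_W0(2) by simp
  then show ?thesis
    using Lambert_W0_gt_1[OF assms] by (simp add: ln_mult_pos)
qed

section \<open>The iteration for a fixed x above e\<close>

context
  fixes x :: real
  assumes x: "x > exp 1"
begin

lemma Lambert_W0_less_ln: "Lambert_W0 x < ln x"
  using Lambert_W0_gt_1[OF x] Lambert_W0_plus_ln[OF x] ln_gt_zero[of "Lambert_W0 x"] by linarith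

lemma diff_ln_ln_ge_1: "1 \<le> ln x - ln (ln x)"
proof -
  have "ln x > 1" using x exp_1_less_iff by blast
  then show ?thesis using ln_le_minus_one[of "ln x"] by linarith
qed

text \<open>The interval is mapped into itself: t \<le> \<open>ln x\<close> gives the lower bound,
  and t \<ge> 1 makes \<open>ln t\<close> nonnegative, giving the upper one.\<close>

lemma lambda_seq_bounds: "lambda_seq x n \<in> {ln x - ln (ln x)..ln x}"
proof (induction n)
  case 0
  show ?case using x by (simp add: exp_1_less_iff)
next
  case (Suc n)
  then show ?case using diff_ln_ln_ge_1 by auto
qed

lemma lambda_seq_less_Lambert_W0_iff:
  "lambda_seq x (Suc n) < Lambert_W0 x \<longleftrightarrow> Lambert_W0 x < lambda_seq x n"
proof -
  have "Lambert_W0 x < lambda_seq x n \<longleftrightarrow> ln (Lambert_W0 x) < ln (lambda_seq x n)"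
    using lambda_seq_bounds[of n] diff_ln_ln_ge_1 Lambert_W0_gt_1[OF x]
    by (subst ln_less_cancel_iff) auto
  then show ?thesis using Lambert_W0_plus_ln[OF x] by auto
qed

lemma Lambert_W0_less_lambda_seq_iff:
  "Lambert_W0 x < lambda_seq x (Suc n) \<longleftrightarrow> lambda_seq x n < Lambert_W0 x"
proof -
  have "lambda_seq x n < Lambert_W0 x \<longleftrightarrow> ln (lambda_seq x n) < ln (Lambert_W0 x)"
    using lambda_seq_bounds[of n] diff_ln_ln_ge_1 Lambert_W0_gt_1[OF x]
    by (subst ln_less_cancel_iff) auto
  then show ?thesis using Lambert_W0_plus_ln[OF x] by auto
qed

lemma Lambert_W0_less_lambda_seq_even: "Lambert_W0 x < lambda_seq x (2 * n)"
proof (induction n)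
  case 0
  show ?case using Lambert_W0_less_ln by simp
next
  case (Suc n)
  then show ?case
    using Lambert_W0_less_lambda_seq_iff[of "Suc (2 * n)"] lambda_seq_less_Lambert_W0_iff[of "2 * n"]
    by simp
qed

lemma abs_lambda_seq_diff_le:
  "\<bar>lambda_seq x n - Lambert_W0 x\<bar> \<le> (1 / (ln x - ln (ln x))) ^ n * ln (ln x)"
proof (induction n)
  case 0
  \<comment> \<open>The initial distance \<open>ln x - Lambert_W0 x\<close> is exactly
    \<open>ln (Lambert_W0 x)\<close>.\<close>
  have "ln (Lambert_W0 x) \<le> ln (ln x)"
    using Lambert_W0_less_ln Lambert_W0_gt_1[OF x] by simp
  then show ?case
    using Lambert_W0_plus_ln[OF x] Lambert_W0_less_ln by simp
next
  case (Suc n)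
  let ?w = "Lambert_W0 x" and ?m = "ln x - ln (ln x)"
  \<comment> \<open>\<open>?m\<close> is the iterate of index 1, hence below \<open>?w\<close>,
    because iterate 0 lies above.\<close>
  have "?m \<le> ?w"
    using lambda_seq_less_Lambert_W0_iff[of 0] Lambert_W0_less_ln by simp
  have "\<bar>lambda_seq x (Suc n) - ?w\<bar> = \<bar>ln (lambda_seq x n) - ln ?w\<bar>"
    using Lambert_W0_plus_ln[OF x] by simp
  also have "\<dots> \<le> \<bar>lambda_seq x n - ?w\<bar> / ?m"
    using lambda_seq_bounds[of n] diff_ln_ln_ge_1 \<open>?m \<le> ?w\<close> by (intro abs_ln_diff_le) auto
  also have "\<dots> \<le> (1 / ?m) ^ n * ln (ln x) / ?m"
    using Suc diff_ln_ln_ge_1 by (intro divide_right_mono) auto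
  finally show ?case by (simp add: field_simps)
qed

text \<open>The distance bound is then geometric with ratio below 1.\<close>

lemma lambda_seq_tendsto:
  assumes "ln x - ln (ln x) > 1"
  shows "lambda_seq x \<longlonglongrightarrow> Lambert_W0 x"
proof -
  let ?m = "ln x - ln (ln x)"
  have "(\<lambda>n. (1 / ?m) ^ n * ln (ln x)) \<longlonglongrightarrow> 0 * ln (ln x)"
    using assms by (intro tendsto_mult tendsto_const LIMSEQ_power_zero) simp
  then have "(\<lambda>n. (1 / ?m) ^ n * ln (ln x)) \<longlonglongrightarrow> 0" by simp
  moreover have "\<forall>\<^sub>F n in sequentially.
      norm (lambda_seq x n - Lambert_W0 x) \<le> (1 / ?m) ^ n * ln (ln x)"
    unfolding real_norm_def by (rule always_eventually) (rule allI, rule abs_lambda_seq_diff_le)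
  ultimately have "(\<lambda>n. lambda_seq x n - Lambert_W0 x) \<longlonglongrightarrow> 0"
    by (rule Lim_null_comparison[rotated])
  then show ?thesis by (rule LIM_zero_cancel)
qed

end

theorem theorem3p2:
  shows "(\<exists>!x. is_x_star3 x) \<and>
    x_star3 \<in> {5.580<..<5.581} \<and>
    (\<forall>x > x_star3.
       lambda_seq x \<longlonglongrightarrow> Lambert_W0 x \<and>
       (\<forall>n::nat.
          0 < lambda_seq x (2 * n) - Lambert_W0 x \<and>
          lambda_seq x (2 * n) - Lambert_W0 x
            \<le> (sqrt (2 * ln 2) / (ln x - ln (ln x))) ^ (2 * n) * ln (ln x)))"
proof (intro conjI allI impI)
  show "\<exists>!x. is_x_star3 x" by (rule ex1_is_x_star3)
  show "x_star3 \<in> {5.580<..<5.581}" by (rule x_star3_bounds)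
  fix x assume "x > x_star3"
  let ?m = "ln x - ln (ln x)" and ?s = "sqrt (2 * ln 2) :: real"
  have x: "x > exp 1" using \<open>x > x_star3\<close> is_x_star3_x_star3 by (simp add: is_x_star3_def)
  \<comment> \<open>\<open>2 * ln 2 > 1\<close> gives the first bound; x lying beyond the threshold
    gives the second.\<close>
  have s: "1 \<le> ?s" "?s < ?m"
    using ln_2_bounds is_x_star3_less_iff(2)[OF is_x_star3_x_star3 x] \<open>x > x_star3\<close> by auto
  show "lambda_seq x \<longlonglongrightarrow> Lambert_W0 x"
    using lambda_seq_tendsto[OF x] s by simp
  fix n :: nat
  show "0 < lambda_seq x (2 * n) - Lambert_W0 x"
    using Lambert_W0_less_lambda_seq_even[OF x] by simp
  have "lambda_seq x (2 * n) - Lambert_W0 x \<le> (1 / ?m) ^ (2 * n) * ln (ln x)"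
    using abs_lambda_seq_diff_le[OF x, of "2 * n"] by linarith
  \<comment> \<open>Since 1 \<le> \<open>?s\<close>, enlarging the ratio weakens the bound to the
    required one.\<close>
  also have "\<dots> \<le> (?s / ?m) ^ (2 * n) * ln (ln x)"
    using s x diff_ln_ln_ge_1[OF x]
    by (intro mult_right_mono power_mono divide_right_mono) (auto simp: exp_1_less_iff)
  finally show "lambda_seq x (2 * n) - Lambert_W0 x \<le> (?s / ?m) ^ (2 * n) * ln (ln x)" .
qed

end
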